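(* Let $I\subset\mathbb{R}$ be an interval, let $f:I\to\mathbb{R}$ be differentiable on the interior $I^{\circ}$ with $f'\in L[a,b]$, where $a,b\in I^{\circ}$, $a<b$. Let $q>1$ and let $p$ satisfy $\frac1p+\frac1q=1$. If $|f'|^{q}$ is quasi-convex on $[a,b]$, then $$\left|f\left(\frac{a+b}{2}\right)-\frac{1}{b-a}\int_a^b f(x)\,dx\right|$$ $$\le \frac{b-a}{4(p+1)^{1/p}}\left[\left(\sup\left\{\left|f'\left(\tfrac{a+b}{2}\right)\right|^q,|f'(a)|^q\right\}\right)^{1/q}+\left(\sup\left\{\left|f'\left(\tfrac{a+b}{2}\right)\right|^q,|f'(b)|^q\right\}\right)^{1/q}\right].$$
   Context: A function $g:[a,b]\to\mathbb{R}$ is quasi-convex on $[a,b]$ if $g(tx+(1-t)y)\le\sup\{g(x),g(y)\}$ for all $x,y\in[a,b]$ and $t\in[0,1]$. $L[a,b]$ denotes the set of Lebesgue integrable functions on $[a,b]$. *)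

theory Defs
  imports "HOL-Analysis.Analysis"
begin

definition quasi_convex_on :: "real set \<Rightarrow> (real \<Rightarrow> real) \<Rightarrow> bool" where
  "quasi_convex_on S g \<longleftrightarrow>
     (\<forall>x\<in>S. \<forall>y\<in>S. \<forall>t\<in>{0..1}. g (t * x + (1 - t) * y) \<le> Sup {g x, g y})"

end

theory Submission
  imports Defs
begin

text \<open>Quasi-convexity bounds \<open>\<bar>f'\<bar>\<close> by constants \<open>L\<close> on the left half and \<open>R\<close> on the right half of
  \<open>[a, b]\<close>. By the mean value theorem \<open>f\<close> differs from its value at the midpoint by at most
  \<open>L\<close> (respectively \<open>R\<close>) times the distance to the midpoint, and integrating gives the bound
  \<open>(b - a) / 8 * (L + R)\<close>. This is stronger than the claim, because \<open>(p + 1) powr (1 / p) \<le> 2\<close> for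
  \<open>p \<ge> 1\<close>.\<close>

text \<open>Taking \<open>p\<close>-th roots reduces this to \<open>p + 1 \<le> 2 powr p\<close>, an
  equality at \<open>p = 1\<close>. It persists beyond because \<open>2 powr x - x\<close> has
  derivative at least \<open>2 * (2 / 3) - 1 > 0\<close> for \<open>x \<ge> 1\<close>.\<close>

lemma powr_add_one_le_two:
  fixes p :: real
  assumes "p \<ge> 1"
  shows "(p + 1) powr (1 / p) \<le> 2"
proof -
  have "2 powr 1 - (1::real) \<le> 2 powr p - p"
  proof (rule DERIV_nonneg_imp_nondecreasing[OF assms])
    fix x :: real
    assume "1 \<le> x"
    then have "2 powr 1 * (2 / 3) \<le> 2 powr x * ln 2"
      using ln2_ge_two_thirds by (intro mult_mono powr_mono) auto
    then have "0 \<le> 2 powr x * ln 2 - 1"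
      by simp
    moreover have "((\<lambda>x. 2 powr x - x) has_real_derivative 2 powr x * ln 2 - 1) (at x)"
      by (auto intro!: derivative_eq_intros)
    ultimately show "\<exists>y. ((\<lambda>x. 2 powr x - x) has_real_derivative y) (at x) \<and> 0 \<le> y"
      by blast
  qed
  then have "p + 1 \<le> 2 powr p"
    by simp
  then have "(p + 1) powr (1 / p) \<le> (2 powr p) powr (1 / p)"
    using assms by (intro powr_mono2) auto
  also have "\<dots> = 2"
    using assms by (simp add: powr_powr)
  finally show ?thesis .
qed

lemma quasi_convex_on_le_Sup_endpoints:
  assumes "quasi_convex_on S g" and "u \<in> S" and "v \<in> S" and "x \<in> closed_segment u v"
  shows "g x \<le> Sup {g u, g v}"
proof -
  obtain t where t: "0 \<le> t" "t \<le> 1" and x: "x = (1 - t) * u + t * v"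
    using assms(4) by (auto simp: closed_segment_def)
  \<comment> \<open>\<open>closed_segment\<close> puts the weight \<open>t\<close> on the second
    point, \<open>quasi_convex_on\<close> on the first, so the definition is instantiated at
    \<open>1 - t\<close>.\<close>
  have "1 - t \<in> {0..1}"
    using t by auto
  then have "g ((1 - t) * u + (1 - (1 - t)) * v) \<le> Sup {g u, g v}"
    using assms(1-3) unfolding quasi_convex_on_def by blast
  then show ?thesis
    by (simp add: x)
qed

text \<open>Taking \<open>q\<close>-th roots is monotone on nonnegative reals. Using
  \<open>closed_segment\<close> leaves the order of \<open>u\<close> and \<open>v\<close> free, so
  the midpoint can come first in both suprema of the theorem.\<close>

lemma quasi_convex_on_powr_imp_abs_le:
  fixes h :: "real \<Rightarrow> real"
  assumes "quasi_convex_on S (\<lambda>x. \<bar>h x\<bar> powr q)" and "q > 0"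
    and "u \<in> S" and "v \<in> S" and "x \<in> closed_segment u v"
  shows "\<bar>h x\<bar> \<le> Sup {\<bar>h u\<bar> powr q, \<bar>h v\<bar> powr q} powr (1 / q)"
proof -
  have "\<bar>h x\<bar> = (\<bar>h x\<bar> powr q) powr (1 / q)"
    using assms(2) by (simp add: powr_powr)
  also have "\<dots> \<le> Sup {\<bar>h u\<bar> powr q, \<bar>h v\<bar> powr q} powr (1 / q)"
    using quasi_convex_on_le_Sup_endpoints[OF assms(1,3,4,5)] assms(2)
    by (intro powr_mono2) auto
  finally show ?thesis .
qed

text \<open>Integrate the mean value estimate
  \<open>\<bar>f c - f x\<bar> \<le> M * \<bar>x - c\<bar>\<close>. Both choices of \<open>c\<close>
  occur later: the midpoint is the right end of one half and the left end of the other.\<close>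

lemma integral_deviation_le:
  fixes f f' :: "real \<Rightarrow> real"
  assumes deriv: "\<And>x. x \<in> {u..v} \<Longrightarrow> (f has_real_derivative f' x) (at x within {u..v})"
    and bound: "\<And>x. x \<in> {u..v} \<Longrightarrow> \<bar>f' x\<bar> \<le> M"
    and "u \<le> v" and "c = u \<or> c = v"
  shows "\<bar>(v - u) * f c - integral {u..v} f\<bar> \<le> M * (v - u)\<^sup>2 / 2"
proof -
  have c: "c \<in> {u..v}"
    using assms(3,4) by auto
  have "continuous_on {u..v} f"
    using deriv by (rule DERIV_continuous_on)
  then have f: "f integrable_on {u..v}"
    by (rule integrable_continuous_interval)
  have G: "((\<lambda>x. M * \<bar>x - c\<bar>) has_integral M * (v - u)\<^sup>2 / 2) {u..v}"
    using assms(4)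
  proof
    assume "c = u"
    \<comment> \<open>The antiderivative is \<open>M * (x - u)\<^sup>2 / 2\<close>.\<close>
    have "((\<lambda>x. M * (x - u)) has_integral M * (v - u)\<^sup>2 / 2 - M * (u - u)\<^sup>2 / 2) {u..v}"
      using assms(3)
      by (intro fundamental_theorem_of_calculus)
        (auto intro!: derivative_eq_intros simp flip: has_real_derivative_iff_has_vector_derivative)
    then have "((\<lambda>x. M * (x - u)) has_integral M * (v - u)\<^sup>2 / 2) {u..v}"
      by simp
    then show ?thesis
      by (rule has_integral_eq[rotated]) (simp add: \<open>c = u\<close>)
  next
    assume "c = v"
    \<comment> \<open>The antiderivative is \<open>- M * (v - x)\<^sup>2 / 2\<close>.\<close>
    have "((\<lambda>x. M * (v - x)) has_integral - M * (v - v)\<^sup>2 / 2 - - M * (v - u)\<^sup>2 / 2) {u..v}"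
      using assms(3)
      by (intro fundamental_theorem_of_calculus)
        (auto intro!: derivative_eq_intros simp: field_simps
          simp flip: has_real_derivative_iff_has_vector_derivative)
    then have "((\<lambda>x. M * (v - x)) has_integral M * (v - u)\<^sup>2 / 2) {u..v}"
      by simp
    then show ?thesis
      by (rule has_integral_eq[rotated]) (simp add: \<open>c = v\<close>)
  qed
  have *: "((\<lambda>x. f c - f x) has_integral (v - u) * f c - integral {u..v} f) {u..v}"
    using has_integral_diff[OF has_integral_const_real[of "f c" u v] integrable_integral[OF f]]
      assms(3) by simp
  have "norm (f c - f x) \<le> M * \<bar>x - c\<bar>" if "x \<in> {u..v}" for x
    using field_differentiable_bound[OF _ deriv, of M x c] bound that c
    by (simp add: abs_minus_commute)
  then have "norm (integral {u..v} (\<lambda>x. f c - f x)) \<le> integral {u..v} (\<lambda>x. M * \<bar>x - c\<bar>)"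
    using * G by (intro integral_norm_bound_integral) auto
  then show ?thesis
    unfolding integral_unique[OF *] integral_unique[OF G] by simp
qed

theorem corollary10:
  fixes I :: "real set" and f f' :: "real \<Rightarrow> real" and a b p q :: real
  assumes "is_interval I"
    and "\<And>x. x \<in> interior I \<Longrightarrow> (f has_real_derivative f' x) (at x)"
    and "a \<in> interior I" and "b \<in> interior I" and "a < b"
    and "f' absolutely_integrable_on {a..b}"
    and "q > 1" and "1 / p + 1 / q = 1"
    and "quasi_convex_on {a..b} (\<lambda>x. \<bar>f' x\<bar> powr q)"
  shows "\<bar>f ((a + b) / 2) - 1 / (b - a) * integral {a..b} f\<bar>
    \<le> (b - a) / (4 * (p + 1) powr (1 / p)) *
       ((Sup {\<bar>f' ((a + b) / 2)\<bar> powr q, \<bar>f' a\<bar> powr q}) powr (1 / q) +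
        (Sup {\<bar>f' ((a + b) / 2)\<bar> powr q, \<bar>f' b\<bar> powr q}) powr (1 / q))"
proof -
  define m where "m = (a + b) / 2"
  define L where "L = Sup {\<bar>f' m\<bar> powr q, \<bar>f' a\<bar> powr q} powr (1 / q)"
  define R where "R = Sup {\<bar>f' m\<bar> powr q, \<bar>f' b\<bar> powr q} powr (1 / q)"
  have m: "a \<le> m" "m \<le> b" "m - a = (b - a) / 2" "b - m = (b - a) / 2"
    using assms(5) by (auto simp: m_def field_simps)
  \<comment> \<open>Convexity of the interior places all of \<open>{a..b}\<close> inside it, so
    \<open>f\<close> is differentiable at every point there, endpoints included.\<close>
  have "convex (interior I)"
    using assms(1) by (simp add: convex_interior is_interval_convex)
  then have "closed_segment a b \<subseteq> interior I"
    using assms(3,4) by (simp add: closed_segment_subset)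
  then have ab: "{a..b} \<subseteq> interior I"
    using assms(5) by (simp add: closed_segment_eq_real_ivl)
  have deriv: "(f has_real_derivative f' x) (at x within S)" if "x \<in> {a..b}" for x S
    using assms(2) ab that by (blast intro: has_field_derivative_at_within)
  have "\<bar>f' x\<bar> \<le> L" if "x \<in> {a..m}" for x
    unfolding L_def using assms(7) m that
    by (intro quasi_convex_on_powr_imp_abs_le[OF assms(9)]) (auto simp: closed_segment_eq_real_ivl)
  then have left: "\<bar>(m - a) * f m - integral {a..m} f\<bar> \<le> L * (m - a)\<^sup>2 / 2"
    using m by (intro integral_deviation_le[where f' = f'] deriv) auto
  have "\<bar>f' x\<bar> \<le> R" if "x \<in> {m..b}" for x
    unfolding R_def using assms(7) m that
    by (intro quasi_convex_on_powr_imp_abs_le[OF assms(9)]) (auto simp: closed_segment_eq_real_ivl)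
  then have right: "\<bar>(b - m) * f m - integral {m..b} f\<bar> \<le> R * (b - m)\<^sup>2 / 2"
    using m by (intro integral_deviation_le[where f' = f'] deriv) auto
  have "f integrable_on {a..b}"
    using deriv by (intro integrable_continuous_interval DERIV_continuous_on)
  then have "integral {a..b} f = integral {a..m} f + integral {m..b} f"
    using m by (simp add: Henstock_Kurzweil_Integration.integral_combine)
  then have "(b - a) * f m - integral {a..b} f =
      ((m - a) * f m - integral {a..m} f) + ((b - m) * f m - integral {m..b} f)"
    by (simp add: algebra_simps)
  then have "\<bar>(b - a) * f m - integral {a..b} f\<bar> \<le> L * (m - a)\<^sup>2 / 2 + R * (b - m)\<^sup>2 / 2"
    using left right by linarith
  \<comment> \<open>Each half has length \<open>(b - a) / 2\<close>, so each squared length over 2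
    is \<open>(b - a)\<^sup>2 / 8\<close>.\<close>
  also have "\<dots> = (b - a) * ((b - a) / 8 * (L + R))"
    unfolding m by (simp add: field_simps power2_eq_square)
  finally have "\<bar>(b - a) * f m - integral {a..b} f\<bar> / (b - a) \<le> (b - a) / 8 * (L + R)"
    using assms(5) by (simp add: pos_divide_le_eq mult.commute)
  also have "\<bar>(b - a) * f m - integral {a..b} f\<bar> / (b - a)
      = \<bar>f m - 1 / (b - a) * integral {a..b} f\<bar>"
    using assms(5) by (subst abs_div_pos) (auto simp: diff_divide_distrib)
  finally have bound: "\<bar>f m - 1 / (b - a) * integral {a..b} f\<bar> \<le> (b - a) / 8 * (L + R)" .
  \<comment> \<open>Since \<open>q > 1\<close>, the reciprocal of \<open>p\<close> lies strictly
    between 0 and 1. Its positivity excludes \<open>p \<le> 0\<close>, including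
    \<open>p = 0\<close>, where \<open>1 / p\<close> would be 0.\<close>
  have "1 / p = 1 - 1 / q"
    using assms(8) by simp
  then have "0 < 1 / p" "1 / p \<le> 1"
    using assms(7) by auto
  then have p: "p \<ge> 1"
    by (simp add: divide_le_eq)
  \<comment> \<open>The claimed denominator is at most \<open>4 * 2 = 8\<close>, so the constant
    obtained is the smaller one; multiplying by the nonnegative \<open>L + R\<close> keeps the
    order.\<close>
  have "(b - a) / 8 \<le> (b - a) / (4 * (p + 1) powr (1 / p))"
    using powr_add_one_le_two[OF p] p assms(5) by (intro divide_left_mono) auto
  moreover have "0 \<le> L + R"
    by (simp add: L_def R_def)
  ultimately have "(b - a) / 8 * (L + R) \<le> (b - a) / (4 * (p + 1) powr (1 / p)) * (L + R)"
    by (rule mult_right_mono)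
  with bound show ?thesis
    by (simp add: m_def L_def R_def)
qed

end
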